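(* Let $a,b$ be integers such that $x^7+ax+b$ is irreducible over $\mathbb{Q}$, let $\theta$ be a root of this polynomial and $K=\mathbb{Q}(\theta)$. If both $a+16$ and $b$ are divisible by $128$, then $K$ is non-monogenic.
   Context: A number field $K$ of degree $n$ with ring of integers $\mathbb{O}_K$ is monogenic if there is $\alpha\in\mathbb{O}_K$ such that $\{1,\alpha,\dots,\alpha^{n-1}\}$ is a $\mathbb{Z}$-basis of $\mathbb{O}_K$ (i.e. $\mathbb{O}_K=\mathbb{Z}[\alpha]$); otherwise it is non-monogenic. *)

theory Defs
  imports "HOL-Computational_Algebra.Computational_Algebra"
begin

interpretation rat_vs: vector_space "\<lambda>(q::rat) (x::'a::field_char_0). of_rat q * x"
  by unfold_locales (simp_all add: algebra_simps of_rat_add of_rat_mult)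

interpretation int_mod: module "\<lambda>(k::int) (x::'a::field_char_0). of_int k * x"
  by unfold_locales (simp_all add: algebra_simps)

definition is_subfield :: "'a::field set \<Rightarrow> bool" where
  "is_subfield K \<longleftrightarrow> 0 \<in> K \<and> 1 \<in> K \<and>
     (\<forall>x\<in>K. \<forall>y\<in>K. x + y \<in> K \<and> x * y \<in> K) \<and>
     (\<forall>x\<in>K. - x \<in> K \<and> inverse x \<in> K)"

(* Number fields are subfields of an arbitrary ambient field of characteristic 0, which takes
   the place of a fixed algebraic closure of the rationals. *)

definition rat_adjoin :: "'a::field_char_0 \<Rightarrow> 'a set" where
  "rat_adjoin \<theta> = is_subfield hull (\<rat> \<union> {\<theta>})"

definition field_degree :: "'a::field_char_0 set \<Rightarrow> nat" where
  "field_degree K = rat_vs.dim K"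

definition ring_of_integers :: "'a::field_char_0 set \<Rightarrow> 'a set" where
  "ring_of_integers K = {x \<in> K. algebraic_int x}"

definition is_Z_basis :: "'a::field_char_0 set \<Rightarrow> 'a set \<Rightarrow> bool" where
  "is_Z_basis B M \<longleftrightarrow> int_mod.independent B \<and> int_mod.span B = M"

definition monogenic :: "'a::field_char_0 set \<Rightarrow> bool" where
  "monogenic K \<longleftrightarrow> (\<exists>\<alpha>\<in>ring_of_integers K.
     is_Z_basis ((\<lambda>i. \<alpha> ^ i) ` {..<field_degree K}) (ring_of_integers K))"

end

theory Submission
  imports Defs "HOL-Computational_Algebra.Field_as_Ring"
begin

text \<open>Above 2 the field has three primes, of ramification index 1, 3, 3 and residue field $F_2$,
  whereas a ring $Z[\alpha]$ has at most two homomorphisms to $F_2$. With $a = 128k - 16$ and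
  $b = 128m$ one finds an explicit order with basis $1, \theta, w_2, \dots, w_6$ and three
  homomorphisms to $F_2$. It is maximal at 2, so an odd multiple $N\alpha$ of an integral generator
  lies in it. Two of the three homomorphisms agree on $N\alpha$, hence on odd multiples of all
  elements of $Z[\alpha]$; but the algebraic integers $w_3$ and $w_6$ separate all three.

  Maximality at 2 rests on one remark: if $x$ is in the order and $x/2$ is integral, then the powers
  of $x/2$ have a common denominator, so some power of $x$ lies in twice the order.\<close>

section \<open>The order and its homomorphisms to the field with two elements\<close>

text \<open>\<open>root\<close> is the equation of \<theta> with a = 128k - 16 and b = 128m.
  \<open>indep\<close> is the form in which irreducibility enters here: \<theta> has degree at least
  7.\<close>

locale septic =
  fixes \<theta> :: "'a::field_char_0" and k m :: int
  assumes root: "\<theta> ^ 7 = 16 * (1 - 8 * of_int k) * \<theta> - 128 * of_int m"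
    and indep: "\<And>c :: int poly. degree c < 7 \<Longrightarrow> poly (map_poly of_int c) \<theta> = 0 \<Longrightarrow> c = 0"
begin

text \<open>The last three elements are $\theta$, $w_2$, $w_3$ times $(w_3 + 1) / 2$. They are integral at 2
  since $w_3$ is 2-adically close to $0$, $1$, $-1$ at the three primes, and $\theta$, $w_2$, $w_3$
  are divisible by 2 at the first one.\<close>

definition "w2 = \<theta>\<^sup>2 / 2"
definition "w3 = \<theta> ^ 3 / 4"
definition "w4 = (\<theta> ^ 4 + 4 * \<theta>) / 8"
definition "w5 = (\<theta> ^ 5 + 4 * \<theta>\<^sup>2) / 16"
definition "w6 = (\<theta> ^ 6 + 4 * \<theta> ^ 3) / 32"

abbreviation K :: 'a where "K \<equiv> of_int k"
abbreviation M :: 'a where "M \<equiv> of_int m"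

text \<open>Only the last product uses the equation: \<theta>^7 / 32 leaves a term \<theta> / 2,
  which the summand 4\<theta> in the numerator of \<open>w4\<close> absorbs.\<close>

lemma table_theta:
  "\<theta> * \<theta> = 2 * w2"
  "\<theta> * w2 = 2 * w3"
  "\<theta> * w3 = 2 * w4 - \<theta>"
  "\<theta> * w4 = 2 * w5"
  "\<theta> * w5 = 2 * w6"
  "\<theta> * w6 = w4 - 4 * K * \<theta> - 4 * M"
proof -
  have "\<theta> * w6 = (\<theta> ^ 7 + 4 * \<theta> ^ 4) / 32"
    by (simp add: w6_def field_simps eval_nat_numeral)
  also have "\<dots> = w4 - 4 * K * \<theta> - 4 * M"
    by (simp add: root w4_def field_simps)
  finally show "\<theta> * w6 = w4 - 4 * K * \<theta> - 4 * M" .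
qed (simp_all add: w2_def w3_def w4_def w5_def w6_def field_simps eval_nat_numeral)

lemma table:
  "w2 * w2 = 2 * w4 - \<theta>"
  "w2 * w3 = 2 * w5 - w2"
  "w2 * w4 = 2 * w6"
  "w2 * w5 = w4 - 4 * K * \<theta> - 4 * M"
  "w2 * w6 = w5 - 4 * K * w2 - 2 * M * \<theta>"
  "w3 * w3 = 2 * w6 - w3"
  "w3 * w4 = w4 - 4 * K * \<theta> - 4 * M"
  "w3 * w5 = w5 - 4 * K * w2 - 2 * M * \<theta>"
  "w3 * w6 = w6 - 4 * K * w3 - 2 * M * w2"
  "w4 * w4 = 2 * w5 - 4 * K * w2 - 2 * M * \<theta>"
  "w4 * w5 = 2 * w6 - 4 * K * w3 - 2 * M * w2"
  "w4 * w6 = (1 - 4 * K) * w4 - 2 * K * \<theta> - 4 * M - 2 * M * w3"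
  "w5 * w5 = (1 - 4 * K) * w4 - 2 * K * \<theta> - 4 * M - 2 * M * w3"
  "w5 * w6 = (1 - 4 * K) * w5 - M * \<theta> - 2 * K * w2 - 2 * M * w4"
  "w6 * w6 = (1 - 4 * K) * w6 - M * w2 - 2 * K * w3 - 2 * M * w5"
proof -
  note T = table_theta
  show 22: "w2 * w2 = 2 * w4 - \<theta>" and 23: "w2 * w3 = 2 * w5 - w2"
    and 24: "w2 * w4 = 2 * w6"  and 33: "w3 * w3 = 2 * w6 - w3"
    by (simp_all add: w2_def w3_def w4_def w5_def w6_def field_simps eval_nat_numeral)
  \<comment> \<open>Twice each of \<open>w2\<close>, ..., \<open>w6\<close> is \<theta> times the
    preceding basis element, up to a multiple of \<theta>. So a doubled product reduces to products
    already known, and the 2 cancels.\<close>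
  have d2: "x = y" if "2 * x = 2 * y" for x y :: 'a using that by simp
  show 25: "w2 * w5 = w4 - 4 * K * \<theta> - 4 * M"
    by (rule d2) (use T in algebra)
  show 26: "w2 * w6 = w5 - 4 * K * w2 - 2 * M * \<theta>"
    by (rule d2) (use T in algebra)
  show 34: "w3 * w4 = w4 - 4 * K * \<theta> - 4 * M"
    by (rule d2) (use T 22 23 24 25 26 in algebra)
  show 35: "w3 * w5 = w5 - 4 * K * w2 - 2 * M * \<theta>"
    by (rule d2) (use T 22 23 24 25 26 in algebra)
  show 36: "w3 * w6 = w6 - 4 * K * w3 - 2 * M * w2"
    by (rule d2) (use T 22 23 24 25 26 in algebra)
  show 44: "w4 * w4 = 2 * w5 - 4 * K * w2 - 2 * M * \<theta>"
    by (rule d2) (use T 22 23 24 25 26 34 35 36 in algebra)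
  show 45: "w4 * w5 = 2 * w6 - 4 * K * w3 - 2 * M * w2"
    by (rule d2) (use T 22 23 24 25 26 34 35 36 in algebra)
  show 46: "w4 * w6 = (1 - 4 * K) * w4 - 2 * K * \<theta> - 4 * M - 2 * M * w3"
    by (rule d2) (use T 22 23 24 25 26 33 34 35 36 in algebra)
  show 55: "w5 * w5 = (1 - 4 * K) * w4 - 2 * K * \<theta> - 4 * M - 2 * M * w3"
    by (rule d2) (use T 22 23 24 25 26 33 34 35 36 46 in algebra)
  show 56: "w5 * w6 = (1 - 4 * K) * w5 - M * \<theta> - 2 * K * w2 - 2 * M * w4"
    by (rule d2) (use T 22 23 24 25 26 33 34 35 36 46 in algebra)
  show 66: "w6 * w6 = (1 - 4 * K) * w6 - M * w2 - 2 * K * w3 - 2 * M * w5"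
    by (rule d2) (use T 22 23 24 25 26 33 34 35 36 46 in algebra)
qed

section \<open>Coordinates and their parities\<close>

definition lin :: "int \<Rightarrow> int \<Rightarrow> int \<Rightarrow> int \<Rightarrow> int \<Rightarrow> int \<Rightarrow> int \<Rightarrow> 'a" where
  "lin c0 c1 c2 c3 c4 c5 c6 = of_int c0 + of_int c1 * \<theta> + of_int c2 * w2 + of_int c3 * w3
     + of_int c4 * w4 + of_int c5 * w5 + of_int c6 * w6"

text \<open>All coordinates are integers, so the lattice is closed under multiplication; their
  residues modulo 2 give the flags needed in \<open>R_mult\<close>.\<close>

lemma lin_mult:
  "lin c0 c1 c2 c3 c4 c5 c6 * \<theta> =
     lin (-4*m*c6) (c0 - c3 - 4*k*c6) (2*c1) (2*c2) (2*c3 + c6) (2*c4) (2*c5)"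
  "lin c0 c1 c2 c3 c4 c5 c6 * w2 =
     lin (-4*m*c5) (-c2 - 4*k*c5 - 2*m*c6) (c0 - c3 - 4*k*c6) (2*c1) (2*c2 + c5) (2*c3 + c6) (2*c4)"
  "lin c0 c1 c2 c3 c4 c5 c6 * w3 =
     lin (-4*m*c4) (-c1 - 4*k*c4 - 2*m*c5) (-c2 - 4*k*c5 - 2*m*c6) (c0 - c3 - 4*k*c6)
       (2*c1 + c4) (2*c2 + c5) (2*c3 + c6)"
  "lin c0 c1 c2 c3 c4 c5 c6 * w4 =
     lin (-4*m*c3 - 4*m*c6) (-4*k*c3 - 2*m*c4 - 2*k*c6) (-4*k*c4 - 2*m*c5) (-4*k*c5 - 2*m*c6)
       (c0 + c3 + (1 - 4*k)*c6) (2*c1 + 2*c4) (2*c2 + 2*c5)"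
  "lin c0 c1 c2 c3 c4 c5 c6 * w5 =
     lin (-4*m*c2 - 4*m*c5) (-4*k*c2 - 2*m*c3 - 2*k*c5 - m*c6) (-4*k*c3 - 2*m*c4 - 2*k*c6)
       (-4*k*c4 - 2*m*c5) (c2 + (1 - 4*k)*c5 - 2*m*c6) (c0 + c3 + (1 - 4*k)*c6) (2*c1 + 2*c4)"
  "lin c0 c1 c2 c3 c4 c5 c6 * w6 =
     lin (-4*m*c1 - 4*m*c4) (-4*k*c1 - 2*m*c2 - 2*k*c4 - m*c5) (-4*k*c2 - 2*m*c3 - 2*k*c5 - m*c6)
       (-4*k*c3 - 2*m*c4 - 2*k*c6) (c1 + (1 - 4*k)*c4 - 2*m*c5) (c2 + (1 - 4*k)*c5 - 2*m*c6)
       (c0 + c3 + (1 - 4*k)*c6)"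
  by (simp_all only: lin_def distrib_right mult.assoc table_theta table
      table_theta[THEN trans[OF mult.commute]] table[THEN trans[OF mult.commute]]
      of_int_add of_int_diff of_int_mult of_int_minus of_int_numeral of_int_1)
    algebra+

text \<open>The flags of \<open>R\<close> are the values of the three homomorphisms, which send
  $(1, w_3, w_6)$ to $(1,0,0)$, $(1,1,0)$, $(1,1,1)$ and all other basis elements to $0$.\<close>

definition R :: "bool \<Rightarrow> bool \<Rightarrow> bool \<Rightarrow> 'a set" where
  "R p q r = {lin c0 c1 c2 c3 c4 c5 c6 | c0 c1 c2 c3 c4 c5 c6.
     p = odd c0 \<and> q = odd (c0 + c3) \<and> r = odd (c0 + c3 + c6)}"

lemma lin_in_R: "lin c0 c1 c2 c3 c4 c5 c6 \<in> R (odd c0) (odd (c0 + c3)) (odd (c0 + c3 + c6))"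
  unfolding R_def by (intro CollectI exI conjI; rule refl)

lemma RE:
  assumes "x \<in> R p q r"
  obtains c0 c1 c2 c3 c4 c5 c6 where "x = lin c0 c1 c2 c3 c4 c5 c6"
    "p = odd c0" "q = odd (c0 + c3)" "r = odd (c0 + c3 + c6)"
  using assms unfolding R_def by (elim CollectE exE conjE) (rule that)

lemma lin_add: "lin c0 c1 c2 c3 c4 c5 c6 + lin d0 d1 d2 d3 d4 d5 d6 =
    lin (c0+d0) (c1+d1) (c2+d2) (c3+d3) (c4+d4) (c5+d5) (c6+d6)"
  unfolding lin_def of_int_add by algebra

lemma lin_scale: "of_int n * lin c0 c1 c2 c3 c4 c5 c6 =
    lin (n*c0) (n*c1) (n*c2) (n*c3) (n*c4) (n*c5) (n*c6)"
  unfolding lin_def of_int_mult by algebra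

lemma R_add:
  assumes "x \<in> R p q r" "y \<in> R p' q' r'"
  shows "x + y \<in> R (p \<noteq> p') (q \<noteq> q') (r \<noteq> r')"
  using assms(1)
proof (cases rule: RE)
  case c: (1 c0 c1 c2 c3 c4 c5 c6)
  from assms(2) show ?thesis
  proof (cases rule: RE)
    case d: (1 d0 d1 d2 d3 d4 d5 d6)
    show ?thesis unfolding c d lin_add R_def
      by (intro CollectI exI conjI, rule refl) (auto simp del: ex_simps)
  qed
qed

lemma R_scale:
  assumes "x \<in> R p q r"
  shows "of_int n * x \<in> R (odd n \<and> p) (odd n \<and> q) (odd n \<and> r)"
  using assms
proof (cases rule: RE)
  case c: (1 c0 c1 c2 c3 c4 c5 c6)
  show ?thesis unfolding c lin_scale R_def
    by (intro CollectI exI conjI, rule refl) (auto simp del: ex_simps simp flip: distrib_left)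
qed

lemma R_mult:
  assumes "x \<in> R p q r" "y \<in> R p' q' r'"
  shows "x * y \<in> R (p \<and> p') (q \<and> q') (r \<and> r')"
  using assms(1)
proof (cases rule: RE)
  case c: (1 c0 c1 c2 c3 c4 c5 c6)
  from assms(2) show ?thesis
  proof (cases rule: RE)
    case d: (1 d0 d1 d2 d3 d4 d5 d6)
    \<comment> \<open>Multiplicativity is checked against one basis element at a time and then
      extended to \<open>y\<close> by additivity.\<close>
    have "x * \<theta> \<in> R False False False" "x * w2 \<in> R False False False"
      "x * w3 \<in> R False q r" "x * w4 \<in> R False False False"
      "x * w5 \<in> R False False False" "x * w6 \<in> R False False r"
      unfolding c lin_mult R_def
      by (intro CollectI exI conjI, rule refl; auto)+
    note m = this[THEN R_scale]
    have "x * y = of_int d0 * x + of_int d1 * (x * \<theta>) + of_int d2 * (x * w2) + of_int d3 * (x * w3)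
       + of_int d4 * (x * w4) + of_int d5 * (x * w5) + of_int d6 * (x * w6)"
      unfolding d lin_def by (simp add: algebra_simps)
    also have "\<dots> \<in> R (odd d0 \<and> p) (odd (d0 + d3) \<and> q) (odd (d0 + d3 + d6) \<and> r)"
      using R_add[OF R_add[OF R_add[OF R_add[OF R_add[OF R_add[OF R_scale[OF assms(1), of d0]
        m(1)[of d1]] m(2)[of d2]] m(3)[of d3]] m(4)[of d4]] m(5)[of d5]] m(6)[of d6]]
      by (elim back_subst[of "\<lambda>X. _ \<in> X"]) (rule arg_cong3[where f = R]; auto)
    finally show ?thesis using d by (simp add: conj_commute)
  qed
qed

lemma lin_eq_0D:
  assumes "lin c0 c1 c2 c3 c4 c5 c6 = 0"
  shows "c0 = 0" "c1 = 0" "c2 = 0" "c3 = 0" "c4 = 0" "c5 = 0" "c6 = 0"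
proof -
  \<comment> \<open>The factor 32 clears all denominators: these are the coefficients of 32 times
    the combination in powers of \<theta>. Read from the top degree down, they force each coordinate
    to vanish.\<close>
  let ?c = "[:32*c0, 32*c1+16*c4, 16*c2+8*c5, 8*c3+4*c6, 4*c4, 2*c5, c6:]"
  have "2 * w2 = \<theta>\<^sup>2" "4 * w3 = \<theta> ^ 3" "8 * w4 = \<theta> ^ 4 + 4 * \<theta>"
    "16 * w5 = \<theta> ^ 5 + 4 * \<theta>\<^sup>2" "32 * w6 = \<theta> ^ 6 + 4 * \<theta> ^ 3"
    by (simp_all add: w2_def w3_def w4_def w5_def w6_def)
  then have "poly (map_poly of_int ?c) \<theta> = 32 * lin c0 c1 c2 c3 c4 c5 c6"
    unfolding lin_def map_poly_pCons[where f = of_int, OF of_int_0] poly_pCons map_poly_0 poly_0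
      of_int_add of_int_mult of_int_numeral by algebra
  then have "poly (map_poly of_int ?c) \<theta> = 0"
    unfolding assms by simp
  moreover have "degree ?c \<le> Suc (Suc (Suc (Suc (Suc (Suc (degree [:c6:]))))))"
    by (intro order_trans[OF degree_pCons_le] Suc_le_mono[THEN iffD2] order_refl)
  then have "degree ?c < 7"
    by simp
  ultimately have "?c = 0"
    by (intro indep)
  then show "c0 = 0" "c1 = 0" "c2 = 0" "c3 = 0" "c4 = 0" "c5 = 0" "c6 = 0"
    unfolding pCons_eq_0_iff by simp_all
qed

text \<open>Coordinates are unique by \<open>lin_eq_0D\<close>, so the three flags are well-defined
  functions on the order.\<close>

lemma R_disjoint:
  assumes "x \<in> R p q r" "x \<in> R p' q' r'"
  shows "p = p' \<and> q = q' \<and> r = r'"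
  using assms(1)
proof (cases rule: RE)
  case c: (1 c0 c1 c2 c3 c4 c5 c6)
  from assms(2) show ?thesis
  proof (cases rule: RE)
    case d: (1 d0 d1 d2 d3 d4 d5 d6)
    have "lin c0 c1 c2 c3 c4 c5 c6 + of_int (-1) * lin d0 d1 d2 d3 d4 d5 d6 = 0"
      using c d by simp
    from lin_eq_0D[OF this[unfolded lin_scale lin_add]] c d show ?thesis by simp
  qed
qed

definition ord :: "'a set" where
  "ord = {x. \<exists>p q r. x \<in> R p q r}"

lemma R_in_ord: "x \<in> R p q r \<Longrightarrow> x \<in> ord"
  unfolding ord_def by blast

lemma lin_in_ord: "lin c0 c1 c2 c3 c4 c5 c6 \<in> ord"
  by (rule R_in_ord[OF lin_in_R])

lemma of_int_in_R: "of_int n \<in> R (odd n) (odd n) (odd n)"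
  using lin_in_R[of n 0 0 0 0 0 0] by (simp add: lin_def)

lemma basis_in_R:
  "\<theta> \<in> R False False False" "w2 \<in> R False False False" "w3 \<in> R False True True"
  "w4 \<in> R False False False" "w5 \<in> R False False False" "w6 \<in> R False False True"
  using lin_in_R[of 0 1 0 0 0 0 0] lin_in_R[of 0 0 1 0 0 0 0] lin_in_R[of 0 0 0 1 0 0 0]
    lin_in_R[of 0 0 0 0 1 0 0] lin_in_R[of 0 0 0 0 0 1 0] lin_in_R[of 0 0 0 0 0 0 1]
  by (simp_all add: lin_def)

lemma ord_add: "x \<in> ord \<Longrightarrow> y \<in> ord \<Longrightarrow> x + y \<in> ord"
  unfolding ord_def using R_add by blast

lemma ord_mult: "x \<in> ord \<Longrightarrow> y \<in> ord \<Longrightarrow> x * y \<in> ord"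
  unfolding ord_def using R_mult by blast

lemma ord_of_int: "of_int n \<in> ord"
  by (rule R_in_ord[OF of_int_in_R])

lemma ord_0: "0 \<in> ord" and ord_1: "1 \<in> ord"
  using ord_of_int[of 0] ord_of_int[of 1] by simp_all

lemma ord_uminus: "x \<in> ord \<Longrightarrow> - x \<in> ord"
  using ord_mult[OF ord_of_int[of "-1"]] by simp

lemma ord_sum: "(\<And>i. i \<in> A \<Longrightarrow> g i \<in> ord) \<Longrightarrow> sum g A \<in> ord"
  by (induction A rule: infinite_finite_induct) (auto intro: ord_0 ord_add)

lemma ord_power: "x \<in> ord \<Longrightarrow> x ^ n \<in> ord"
  by (induction n) (auto intro: ord_1 ord_mult)

lemma R_power: "x \<in> R p q r \<Longrightarrow> x ^ Suc n \<in> R p q r"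
proof (induction n)
  case (Suc n)
  from R_mult[OF Suc.prems Suc.IH[OF Suc.prems]] show ?case by simp
qed simp

text \<open>If 2^t is the exact power of 2 in \<open>C\<close>, the exponent t + 1 leaves one factor
  2 uncancelled: an odd multiple of x^(t+1) is twice an element of the order. All three
  homomorphisms kill it, hence kill \<open>x\<close>.\<close>

lemma half_powers_unbounded:
  assumes x: "x \<in> R p q r" and "C \<noteq> 0" and bd: "\<And>n. of_int C * (x / 2) ^ n \<in> ord"
  shows "\<not> p" "\<not> q" "\<not> r"
proof -
  obtain t c where C: "C = 2 ^ t * c" "odd c"
  proof -
    have fin: "\<not> is_unit (2 :: int)" by simp
    obtain c where "C = 2 ^ multiplicity 2 C * c" "\<not> 2 dvd c"
      by (rule multiplicity_decompose'[OF \<open>C \<noteq> 0\<close> fin])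
    then show ?thesis by (rule that)
  qed
  obtain p' q' r' where y: "of_int C * (x / 2) ^ Suc t \<in> R p' q' r'"
    using bd[of "Suc t"] unfolding ord_def by blast
  have "of_int 2 * (of_int C * (x / 2) ^ Suc t) = of_int c * x ^ Suc t"
    by (simp add: C power_divide)
  moreover have "of_int 2 * (of_int C * (x / 2) ^ Suc t) \<in> R False False False"
    using R_scale[OF y, of 2] unfolding even_numeral by simp
  moreover have "of_int c * x ^ Suc t \<in> R p q r"
    using R_scale[OF R_power[OF x, of t], of c] by (simp only: C(2) simp_thms)
  ultimately have "False = p \<and> False = q \<and> False = r"
    using R_disjoint by metis
  then show "\<not> p" "\<not> q" "\<not> r"
    by blast+
qed

end

section \<open>Maximality at 2\<close>

text \<open>\<open>S\<close> will be the ring generated over the order by an integral element.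
  Integrality is kept only as the common denominator \<open>C\<close>, which is what the argument
  with powers needs.\<close>

locale bounded_overring = septic +
  fixes S :: "'a set" and C :: int
  assumes ord_sub: "ord \<subseteq> S"
    and S_add: "x \<in> S \<Longrightarrow> y \<in> S \<Longrightarrow> x + y \<in> S"
    and S_mult: "x \<in> S \<Longrightarrow> y \<in> S \<Longrightarrow> x * y \<in> S"
    and C: "C \<noteq> 0" "x \<in> S \<Longrightarrow> of_int C * x \<in> ord"
begin

lemma S_power: "x \<in> S \<Longrightarrow> x ^ n \<in> S"
  using ord_sub ord_1 by (induction n) (auto intro: S_mult)

lemma half_parity:
  assumes "x \<in> R p q r" "x / 2 \<in> S"
  shows "\<not> p" "\<not> q" "\<not> r"
  using half_powers_unbounded[OF assms(1) C(1)] C(2)[OF S_power[OF assms(2)]] by auto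

lemma half_shift:
  assumes "x / 2 \<in> S" "y \<in> ord" "z = x + 2 * y"
  shows "z / 2 \<in> S"
  using S_add[OF assms(1) subsetD[OF ord_sub assms(2)]] assms(3) by (simp add: add_divide_distrib)

text \<open>Only parities matter, so it suffices to exclude z / 2 for z = \<theta>,
  \<open>w4\<close> and \<theta> - \<open>w4\<close>. In each case z^3 = 4y, so (z / 2)^3 = y / 2
  lies in \<open>S\<close>, although some homomorphism does not kill y.\<close>

lemma theta_w4_even:
  assumes S: "(of_int d * \<theta> + of_int e * w4) / 2 \<in> S"
  shows "even d \<and> even e"
proof -
  have shift: "(of_int d' * \<theta> + of_int e' * w4) / 2 \<in> S" if "even (d' - d)" "even (e' - e)" for d' e'
  proof -
    from that obtain s t where st: "d' - d = 2 * s" "e' - e = 2 * t" by (elim evenE)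
    then have "d' = d + 2 * s" "e' = e + 2 * t" by simp_all
    then have "of_int d' * \<theta> + of_int e' * w4
        = (of_int d * \<theta> + of_int e * w4) + 2 * lin 0 s 0 0 t 0 0"
      by (simp add: lin_def algebra_simps)
    with half_shift[OF S lin_in_ord] show ?thesis by blast
  qed
  have cube: False if "z / 2 \<in> S" "z * z * z = 4 * y" "y \<in> R p q r" "p \<or> q \<or> r" for z y p q r
  proof -
    have "(z / 2) ^ 3 = z * z * z / 8"
      by (simp add: eval_nat_numeral)
    also have "\<dots> = y / 2"
      unfolding that(2) by simp
    finally have "(z / 2) ^ 3 = y / 2" .
    with half_parity[OF that(3)] S_power[OF that(1), of 3] that(4) show False by auto
  qed
  note T = table_theta table
  consider "even d" "even e" | "odd d" "even e" | "even d" "odd e" | "odd d" "odd e" by blast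
  then show ?thesis
  proof cases
    case 2
    from shift[of 1 0] 2 have "\<theta> / 2 \<in> S" by simp
    moreover have "\<theta> * \<theta> * \<theta> = 4 * w3"
      by (simp add: w3_def eval_nat_numeral)
    ultimately show ?thesis using cube basis_in_R(3) by blast
  next
    case 3
    from shift[of 0 1] 3 have "w4 / 2 \<in> S" by simp
    moreover have "w4 * w4 * w4 = 4 * lin 0 0 (- m) (- 2 * k) 0 (- m) (1 - 2 * k)"
      unfolding lin_def of_int_diff of_int_mult of_int_minus of_int_numeral of_int_1 of_int_0
      using T(1-6) T(7-11) T(16-17) by algebra
    moreover note lin_in_R
    ultimately have False by (rule cube) simp
    then show ?thesis ..
  next
    case 4
    \<comment> \<open>The sign is free modulo twice the order; with this one the multiples of
      \<open>w6\<close> from the two mixed terms of the cube cancel.\<close>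
    from shift[of 1 "-1"] 4 have "(\<theta> - w4) / 2 \<in> S" by simp
    moreover have "(\<theta> - w4) * (\<theta> - w4) * (\<theta> - w4) =
        4 * lin 0 0 (- 2 * m) (1 - 4 * k) 0 m (- (1 - 2 * k))"
      unfolding lin_def of_int_diff of_int_mult of_int_minus of_int_numeral of_int_1 of_int_0
      using T(1-6) T(7-11) T(16-17) by algebra
    moreover note lin_in_R
    ultimately have False by (rule cube) simp
    then show ?thesis ..
  qed blast
qed

text \<open>The coordinates of \<open>x\<close> are shown to be even in three rounds, along a
  filtration of the order modulo 2: first the quotient by the radical, seen by the flags, then the
  radical modulo its socle, then the socle.\<close>

lemma half_in_ord:
  assumes "x \<in> ord" "x / 2 \<in> S"
  shows "x / 2 \<in> ord"
proof -
  from assms(1) obtain p q r where "x \<in> R p q r"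
    unfolding ord_def by blast
  then obtain c0 c1 c2 c3 c4 c5 c6 where x: "x = lin c0 c1 c2 c3 c4 c5 c6"
    by (rule RE)
  have "even c0" "even (c0 + c3)" "even (c0 + c3 + c6)"
    using half_parity[OF lin_in_R assms(2)[unfolded x]] by simp_all
  then have "even c3" "even c6" by simp_all
  from \<open>even c0\<close> \<open>even c3\<close> \<open>even c6\<close> obtain d0 d3 d6 where
    d: "c0 = 2 * d0" "c3 = 2 * d3" "c6 = 2 * d6" by (elim evenE)
  have S: "lin 0 c1 c2 0 c4 c5 0 / 2 \<in> S"
    by (rule half_shift[OF assms(2) lin_in_ord[of "- d0" 0 0 "- d3" 0 0 "- d6"]])
      (unfold x lin_def d of_int_add of_int_diff of_int_mult of_int_minus
        of_int_numeral of_int_0, algebra)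
  \<comment> \<open>Modulo 2, multiplication by \<open>w2\<close> kills \<open>\<theta>\<close> and \<open>w4\<close>, which span the socle of
    the radical, and maps \<open>w2\<close> and \<open>w5\<close> to \<open>\<theta>\<close> and \<open>w4\<close>.\<close>
  have "(lin 0 c1 c2 0 c4 c5 0 * w2) / 2 \<in> S"
    using S_mult[OF S subsetD[OF ord_sub R_in_ord[OF basis_in_R(2)]]] by simp
  then have "(of_int (- c2) * \<theta> + of_int c5 * w4) / 2 \<in> S"
    by (rule half_shift[OF _ lin_in_ord[of "2*m*c5" "2*k*c5" 0 "- c1" "- c2" 0 "- c4"]])
      (unfold lin_mult, unfold lin_def of_int_add of_int_diff of_int_mult of_int_minus
        of_int_numeral of_int_0, algebra)
  from theta_w4_even[OF this] have "even c2" "even c5" by simp_all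
  then obtain d2 d5 where d': "c2 = 2 * d2" "c5 = 2 * d5" by (elim evenE)
  have "(of_int c1 * \<theta> + of_int c4 * w4) / 2 \<in> S"
    by (rule half_shift[OF S lin_in_ord[of 0 0 "- d2" 0 0 "- d5" 0]])
      (unfold lin_def d' of_int_add of_int_diff of_int_mult of_int_minus
        of_int_numeral of_int_0, algebra)
  from theta_w4_even[OF this] obtain d1 d4 where "c1 = 2 * d1" "c4 = 2 * d4" by (elim conjE evenE)
  with d d' have "x = of_int 2 * lin d0 d1 d2 d3 d4 d5 d6"
    unfolding lin_scale x by (simp only:)
  then show ?thesis by (simp add: lin_in_ord)
qed

end

section \<open>Integral elements: odd denominators and the pigeonhole argument\<close>

context septic
begin

text \<open>With n the degree of an integral equation, D^n clears every power below the n-th. Higher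
  powers reduce to these by the equation, whose integer coefficients bring in no new
  denominator.\<close>

lemma bounded_powers:
  assumes "algebraic_int \<alpha>" "of_int D * \<alpha> \<in> ord"
  obtains n where "\<And>j. of_int (D ^ n) * \<alpha> ^ j \<in> ord"
proof -
  obtain P :: "int poly" where P: "poly (map_poly of_int P) \<alpha> = 0" "lead_coeff P = 1"
    using assms(1) unfolding algebraic_int_altdef_ipoly by blast
  define n where "n = degree P"
  have "0 = (\<Sum>i\<le>n. of_int (coeff P i) * \<alpha> ^ i)"
    using P(1) by (simp add: poly_altdef n_def degree_map_poly coeff_map_poly)
  also have "\<dots> = (\<Sum>i<n. of_int (coeff P i) * \<alpha> ^ i) + \<alpha> ^ n"
    using P(2) by (simp add: n_def flip: lessThan_Suc_atMost)
  finally have red: "\<alpha> ^ n = - (\<Sum>i<n. of_int (coeff P i) * \<alpha> ^ i)"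
    by (simp add: eq_neg_iff_add_eq_0 add.commute)
  have "of_int (D ^ n) * \<alpha> ^ j \<in> ord" for j
  proof (induction j rule: less_induct)
    case (less j)
    show ?case
    proof (cases "j < n")
      case True
      then have "of_int (D ^ n) * \<alpha> ^ j = of_int (D ^ (n - j)) * (of_int D * \<alpha>) ^ j"
        by (simp add: power_mult_distrib flip: power_add mult.assoc)
      then show ?thesis
        using ord_mult ord_of_int ord_power assms(2) by presburger
    next
      case False
      then have "\<alpha> ^ j = \<alpha> ^ (j - n) * \<alpha> ^ n"
        by (simp flip: power_add)
      then have "of_int (D ^ n) * \<alpha> ^ j
          = - (\<Sum>i<n. of_int (coeff P i) * (of_int (D ^ n) * \<alpha> ^ (j - n + i)))"
        unfolding red by (simp add: sum_distrib_left power_add mult_ac)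
      also have "\<dots> \<in> ord"
        using False by (intro ord_uminus ord_sum ord_mult[OF ord_of_int] less) auto
      finally show ?thesis .
    qed
  qed
  then show ?thesis by (rule that)
qed

text \<open>As long as the denominator is even, \<open>half_in_ord\<close> allows it to be halved,
  so the descent ends at an odd one.\<close>

lemma odd_multiple_in_ord:
  assumes int: "algebraic_int \<alpha>" and D: "D \<noteq> 0" "of_int D * \<alpha> \<in> ord"
  obtains N where "odd N" "of_int N * \<alpha> \<in> ord"
proof -
  obtain n where n: "\<And>j. of_int (D ^ n) * \<alpha> ^ j \<in> ord"
    using bounded_powers[OF int D(2)] by blast
  \<comment> \<open>This is the ring obtained by adjoining \<alpha> to the order; clearing the
    powers of \<alpha> clears all of it.\<close>
  define S where "S = {poly p \<alpha> | p. \<forall>i. coeff p i \<in> ord}"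
  interpret bounded_overring \<theta> k m S "D ^ n"
  proof
    show "ord \<subseteq> S"
    proof
      fix x assume "x \<in> ord"
      then have "\<forall>i. coeff [:x:] i \<in> ord"
        by (auto simp: coeff_pCons ord_0 split: nat.split)
      then show "x \<in> S" unfolding S_def by (intro CollectI exI[of _ "[:x:]"]) simp
    qed
    show "x + y \<in> S" if "x \<in> S" "y \<in> S" for x y
    proof -
      from that obtain p q where "x = poly p \<alpha>" "y = poly q \<alpha>"
        "\<forall>i. coeff p i \<in> ord" "\<forall>i. coeff q i \<in> ord" unfolding S_def by blast
      then show ?thesis
        unfolding S_def by (intro CollectI exI[of _ "p + q"]) (auto intro: ord_add)
    qed
    show "x * y \<in> S" if "x \<in> S" "y \<in> S" for x y
    proof -
      from that obtain p q where "x = poly p \<alpha>" "y = poly q \<alpha>"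
        "\<forall>i. coeff p i \<in> ord" "\<forall>i. coeff q i \<in> ord" unfolding S_def by blast
      then show ?thesis
        unfolding S_def
        by (intro CollectI exI[of _ "p * q"]) (auto simp: coeff_mult intro!: ord_sum ord_mult)
    qed
    show "D ^ n \<noteq> 0" using D(1) by simp
    show "of_int (D ^ n) * x \<in> ord" if "x \<in> S" for x
    proof -
      from that obtain p where p: "x = poly p \<alpha>" "\<forall>i. coeff p i \<in> ord" unfolding S_def by blast
      have "of_int (D ^ n) * x = (\<Sum>i\<le>degree p. coeff p i * (of_int (D ^ n) * \<alpha> ^ i))"
        by (simp add: p poly_altdef sum_distrib_left mult_ac)
      also have "\<dots> \<in> ord"
        using p by (intro ord_sum ord_mult n) simp
      finally show ?thesis .
    qed
  qed
  have "poly [:0, 1:] \<alpha> \<in> S" unfolding S_def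
    by (intro CollectI exI[of _ "[:0, 1:]"]) (auto simp: coeff_pCons ord_0 ord_1 split: nat.split)
  then have alpha: "\<alpha> \<in> S" by simp
  have "\<exists>N. odd N \<and> of_int N * \<alpha> \<in> ord" if "D \<noteq> 0" "of_int D * \<alpha> \<in> ord" for D
    using that
  proof (induction "nat \<bar>D\<bar>" arbitrary: D rule: less_induct)
    case less
    show ?case
    proof (cases "odd D")
      case False
      then obtain E where E: "D = 2 * E" by blast
      have "of_int E * \<alpha> \<in> S"
        using S_mult alpha ord_sub ord_of_int by blast
      then have "of_int E * \<alpha> \<in> ord"
        using half_in_ord[OF less.prems(2)] by (simp add: E)
      then show ?thesis
        using less.hyps[of E] less.prems(1) by (simp add: E)
    qed (use less.prems in blast)
  qed
  from this[OF D] that show ?thesis by blast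
qed

lemma not_both_polynomials:
  assumes int: "algebraic_int \<alpha>" and D: "D \<noteq> 0" "of_int D * \<alpha> \<in> ord"
    and f: "w3 = poly (map_poly of_int f) \<alpha>" and g: "w6 = poly (map_poly of_int g) \<alpha>"
  shows False
proof -
  obtain N where N: "odd N" "of_int N * \<alpha> \<in> ord"
    using odd_multiple_in_ord[OF int D] .
  from N(2) obtain p q r where pqr: "of_int N * \<alpha> \<in> R p q r" unfolding ord_def by blast
  \<comment> \<open>The elements on which any two of the homomorphisms agree that agree on
    N\<alpha>. They form a ring containing the integers and N\<alpha>.\<close>
  define T where "T = {x. \<exists>p' q' r'. x \<in> R p' q' r' \<and>
    (p = q \<longrightarrow> p' = q') \<and> (p = r \<longrightarrow> p' = r') \<and> (q = r \<longrightarrow> q' = r')}"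
  have TI: "x \<in> T" if "x \<in> R p' q' r'"
    "p = q \<Longrightarrow> p' = q'" "p = r \<Longrightarrow> p' = r'" "q = r \<Longrightarrow> q' = r'" for x p' q' r'
    using that unfolding T_def by (intro CollectI exI conjI impI)
  have TE: thesis if "x \<in> T"
    "\<And>p' q' r'. x \<in> R p' q' r' \<Longrightarrow> (p = q \<Longrightarrow> p' = q') \<Longrightarrow> (p = r \<Longrightarrow> p' = r')
      \<Longrightarrow> (q = r \<Longrightarrow> q' = r') \<Longrightarrow> thesis" for x thesis
    using that(1) unfolding T_def by (elim CollectE exE conjE) (rule that(2); simp)
  have T_int: "of_int n \<in> T" for n
    by (rule TI[OF of_int_in_R]) simp_all
  have T_add: "x + y \<in> T" if "x \<in> T" "y \<in> T" for x y
    using that by (elim TE) (rule TI[OF R_add]; simp)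
  have T_mult: "x * y \<in> T" if "x \<in> T" "y \<in> T" for x y
    using that by (elim TE) (rule TI[OF R_mult]; simp)
  have T_alpha: "of_int N * \<alpha> \<in> T"
    by (rule TI[OF pqr])
  have T_power: "x ^ n \<in> T" if "x \<in> T" for x n
    using that T_int[of 1] by (induction n) (auto intro: T_mult)
  have T_sum: "sum h A \<in> T" if "\<And>i. i \<in> A \<Longrightarrow> h i \<in> T" for h and A :: "nat set"
    using that T_int[of 0] by (induction A rule: infinite_finite_induct) (auto intro: T_add)
  \<comment> \<open>Homogenising: N^(deg h) h(\<alpha>) is an integer polynomial in
    N\<alpha>.\<close>
  have T_poly: "of_int (N ^ degree h) * poly (map_poly of_int h) \<alpha> \<in> T" for h
  proof -
    have "of_int (N ^ degree h) * poly (map_poly of_int h) \<alpha>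
        = (\<Sum>i\<le>degree h. of_int (N ^ degree h) * (of_int (coeff h i) * \<alpha> ^ i))"
      by (simp add: poly_altdef degree_map_poly coeff_map_poly sum_distrib_left)
    also have "\<dots> =
        (\<Sum>i\<le>degree h. of_int (coeff h i) * (of_int (N ^ (degree h - i)) * (of_int N * \<alpha>) ^ i))"
    proof (rule sum.cong[OF refl])
      fix i assume "i \<in> {..degree h}"
      then have "N ^ degree h = N ^ (degree h - i) * N ^ i"
        by (simp flip: power_add)
      then show "of_int (N ^ degree h) * (of_int (coeff h i) * \<alpha> ^ i)
          = of_int (coeff h i) * (of_int (N ^ (degree h - i)) * (of_int N * \<alpha>) ^ i)"
        by (simp add: power_mult_distrib)
    qed
    also have "\<dots> \<in> T"
      by (intro T_sum T_mult T_int T_power T_alpha)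
    finally show ?thesis .
  qed
  have w3: "of_int (N ^ degree f) * w3 \<in> R False True True"
    using R_scale[OF basis_in_R(3), of "N ^ degree f"] N(1) by simp
  have w6: "of_int (N ^ degree g) * w6 \<in> R False False True"
    using R_scale[OF basis_in_R(6), of "N ^ degree g"] N(1) by simp
  \<comment> \<open>Odd factors leave flags unchanged, so \<open>w3\<close> separates the first
    homomorphism from the other two, and \<open>w6\<close> separates the last two. Three truth
    values cannot be pairwise distinct.\<close>
  have "p \<noteq> q" "p \<noteq> r"
    using T_poly[of f, folded f] R_disjoint[OF w3] by (elim TE; blast)+
  moreover have "q \<noteq> r"
    using T_poly[of g, folded g] R_disjoint[OF w6] by (elim TE; blast)
  ultimately show False by blast
qed

section \<open>Integrality of the separating elements\<close>

text \<open>Since \<theta>^6 / 16 is the square of \<open>w3\<close>, the equation of \<theta> is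
  linear in \<theta> over the rational functions of \<open>w3\<close>; cubing turns the factor
  \<theta> into 4 \<open>w3\<close>.\<close>

lemma w3_eq: "w3 * (w3\<^sup>2 - (1 - 8 * K)) ^ 3 = - 128 * M ^ 3"
proof -
  have "\<theta> * (w3\<^sup>2 - (1 - 8 * K)) = \<theta> ^ 7 / 16 - (1 - 8 * K) * \<theta>"
    by (simp add: w3_def field_simps eval_nat_numeral)
  also have "\<dots> = - 8 * M"
    by (simp add: root field_simps)
  finally have "(\<theta> * (w3\<^sup>2 - (1 - 8 * K))) ^ 3 = (- 8 * M) ^ 3"
    by simp
  moreover have "\<theta> ^ 3 = 4 * w3"
    by (simp add: w3_def)
  ultimately show ?thesis
    by (simp add: power_mult_distrib)
qed

lemma algebraic_int_w3: "algebraic_int w3"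
  unfolding algebraic_int_altdef_ipoly
proof (intro exI conjI)
  define u where "u = 1 - 8 * k"
  \<comment> \<open>The expansion of T(T^2 - u)^3 + 128 m^3, as in \<open>w3_eq\<close>.\<close>
  let ?p = "[:128 * m ^ 3, - (u ^ 3), 0, 3 * u\<^sup>2, 0, - 3 * u, 0, 1:]"
  show "lead_coeff ?p = 1" by simp
  have u: "of_int u = 1 - 8 * K" by (simp add: u_def)
  show "poly (map_poly of_int ?p) w3 = 0"
    unfolding map_poly_pCons[where f = of_int, OF of_int_0] poly_pCons map_poly_0 poly_0
      of_int_mult of_int_power of_int_minus of_int_numeral of_int_0 of_int_1 u
    using w3_eq by algebra
qed

text \<open>If $Q(T) = T(T^2-u)^3 + 128 m^3$ is the polynomial of \<open>w3\<close>, then the polynomial of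
  \<open>w6 = (w3\<^sup>2 + w3) / 2\<close> below is the resultant of $Q(T)$ and $T^2 + T - 2X$, divided by $-128$.\<close>

lemma algebraic_int_w6: "algebraic_int w6"
  unfolding algebraic_int_altdef_ipoly
proof (intro exI conjI)
  \<comment> \<open>Here v = u(1 - u) / 4, an integer. It arises from (T^2 - u)((T + 1)^2 - u) =
    4(X^2 - uX - v) for T^2 + T = 2X, so the part of \<open>?p\<close> free of m is X(X^2 - uX -
    v)^3.\<close>
  define u v where "u = 1 - 8 * k" and "v = 2 * k * u"
  let ?p = "[:- (m ^ 3) * (- 1 + 3 * u - 3 * u\<^sup>2 + u ^ 3) - 128 * m ^ 6,
    - (v ^ 3) - m ^ 3 * (- 14 + 30 * u - 18 * u\<^sup>2), - 3 * u * v\<^sup>2 - m ^ 3 * (- 56 + 60 * u),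
    3 * v\<^sup>2 - 3 * u\<^sup>2 * v + 56 * m ^ 3, 6 * u * v - u ^ 3, 3 * u\<^sup>2 - 3 * v, - 3 * u, 1:]"
  show "lead_coeff ?p = 1" by simp
  define Q where "Q T = T * (T\<^sup>2 - (1 - 8 * K)) ^ 3 + 128 * M ^ 3" for T
  have w6: "w3 * w3 = 2 * w6 - w3" by (rule table)
  have u: "of_int u = 1 - 8 * K" and v: "of_int v = 2 * K * (1 - 8 * K)"
    by (simp_all add: u_def v_def)
  \<comment> \<open>For X = \<open>w6\<close> the roots of T^2 + T - 2X are \<open>w3\<close> and -1
    - \<open>w3\<close>, so the resultant is this product.\<close>
  have "- 128 * poly (map_poly of_int ?p) w6 = Q w3 * Q (- 1 - w3)"
    unfolding map_poly_pCons[where f = of_int, OF of_int_0] poly_pCons map_poly_0 poly_0 Q_def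
      of_int_add of_int_diff of_int_mult of_int_power of_int_minus of_int_numeral of_int_0
      of_int_1 u v
    using w6 by algebra
  also have "Q w3 = 0"
    by (simp add: Q_def w3_eq)
  finally show "poly (map_poly of_int ?p) w6 = 0" by simp
qed

end

section \<open>Simple extensions of the rationals\<close>

lemma poly_map_poly_hom:
  fixes h :: "'b::comm_ring_1 \<Rightarrow> 'c::comm_ring_1"
  assumes h: "h 0 = 0" "\<And>x y. h (x + y) = h x + h y" "\<And>x y. h (x * y) = h x * h y"
  shows "poly (map_poly h (p + q)) x = poly (map_poly h p) x + poly (map_poly h q) x"
    and "poly (map_poly h (smult c q)) x = h c * poly (map_poly h q) x"
    and "poly (map_poly h (p * q)) x = poly (map_poly h p) x * poly (map_poly h q) x"
proof -
  show add: "poly (map_poly h (p + q)) x = poly (map_poly h p) x + poly (map_poly h q) x" for p q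
    by (induction p q rule: poly_induct2) (simp_all add: map_poly_pCons h algebra_simps)
  show smult: "poly (map_poly h (smult c q)) x = h c * poly (map_poly h q) x" for c q
    by (induction q) (simp_all add: map_poly_pCons h algebra_simps)
  show "poly (map_poly h (p * q)) x = poly (map_poly h p) x * poly (map_poly h q) x"
    by (induction p) (simp_all add: map_poly_pCons h algebra_simps add smult)
qed

lemmas poly_of_rat_hom =
  poly_map_poly_hom[where h = of_rat, OF of_rat_0 of_rat_add of_rat_mult]

lemmas poly_of_int_hom =
  poly_map_poly_hom[where h = of_int, OF of_int_0 of_int_add of_int_mult]

lemma rat_adjoin_base: "\<theta> \<in> rat_adjoin \<theta>" "of_rat q \<in> rat_adjoin \<theta>"
  unfolding rat_adjoin_def by (auto intro: hull_inc)

lemma rat_adjoin_add: "x \<in> rat_adjoin \<theta> \<Longrightarrow> y \<in> rat_adjoin \<theta> \<Longrightarrow> x + y \<in> rat_adjoin \<theta>"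
  and rat_adjoin_mult: "x \<in> rat_adjoin \<theta> \<Longrightarrow> y \<in> rat_adjoin \<theta> \<Longrightarrow> x * y \<in> rat_adjoin \<theta>"
  unfolding rat_adjoin_def hull_def is_subfield_def by blast+

lemma poly_in_rat_adjoin: "poly (map_poly of_rat g) \<theta> \<in> rat_adjoin \<theta>"
proof (induction g)
  case 0
  then show ?case using rat_adjoin_base(2)[of 0] by simp
next
  case (pCons a p)
  then show ?case
    by (simp add: map_poly_pCons rat_adjoin_add rat_adjoin_mult rat_adjoin_base)
qed

text \<open>An irreducible f not dividing g is coprime to g; the inverse is a Bezout coefficient
  evaluated at \<theta>.\<close>

lemma irreducible_root_inverse:
  fixes f g :: "rat poly" and \<theta> :: "'a::field_char_0"
  assumes "irreducible f" "poly (map_poly of_rat f) \<theta> = 0" "\<not> f dvd g"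
  obtains g' where "poly (map_poly of_rat g') \<theta> * poly (map_poly of_rat g) \<theta> = 1"
proof -
  have "coprime f g"
    by (rule prime_elem_imp_coprime[OF irreducible_imp_prime_elem_gcd[OF assms(1)] assms(3)])
  then obtain r s where "r * f + s * g = 1"
    using bezout_coefficients_fst_snd[of f g] by (auto simp: coprime_iff_gcd_eq_1)
  then have "poly (map_poly of_rat (r * f + s * g)) \<theta> = 1"
    by simp
  then have "poly (map_poly of_rat s) \<theta> * poly (map_poly of_rat g) \<theta> = 1"
    using assms(2) by (simp add: poly_of_rat_hom)
  then show ?thesis by (rule that)
qed

lemma rat_adjoin_poly:
  fixes f :: "rat poly" and \<theta> :: "'a::field_char_0"
  assumes f: "irreducible f" "poly (map_poly of_rat f) \<theta> = 0" and x: "x \<in> rat_adjoin \<theta>"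
  obtains g where "x = poly (map_poly of_rat g) \<theta>"
proof -
  let ?E = "\<lambda>g. poly (map_poly of_rat g) \<theta>"
  have "is_subfield (range ?E)"
    unfolding is_subfield_def
  proof (intro conjI ballI)
    show "0 \<in> range ?E" by (rule range_eqI[of _ _ 0]) simp
    show "1 \<in> range ?E" by (rule range_eqI[of _ _ 1]) simp
  next
    fix y z assume "y \<in> range ?E" "z \<in> range ?E"
    then obtain p q where "y = ?E p" "z = ?E q" by blast
    then show "y + z \<in> range ?E" "y * z \<in> range ?E"
      using poly_of_rat_hom(1,3)[of p q \<theta>] by (metis rangeI)+
  next
    fix y assume "y \<in> range ?E"
    then obtain g where g: "y = ?E g" by blast
    then have "- y = ?E (smult (- 1) g)"
      by (simp add: poly_of_rat_hom(2) del: smult_minus_left smult_1_left)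
    then show "- y \<in> range ?E" by blast
    show "inverse y \<in> range ?E"
    proof (cases "f dvd g")
      case True
      then obtain h where "g = f * h" by blast
      then have "y = ?E 0"
        using f(2) by (simp add: g poly_of_rat_hom)
      \<comment> \<open>The value is 0 here, and \<open>inverse 0 = 0\<close> by convention.\<close>
      then show ?thesis by (intro range_eqI[of _ _ 0]) simp
    next
      case False
      from irreducible_root_inverse[OF f this] obtain g' where "?E g' * y = 1"
        unfolding g .
      then have "inverse y = ?E g'"
        by (metis inverse_unique mult.commute)
      then show ?thesis by blast
    qed
  qed
  moreover have "of_rat q \<in> range ?E" for q
    by (rule range_eqI[of _ _ "[:q:]"]) (simp add: map_poly_pCons)
  then have "\<rat> \<subseteq> range ?E" by (auto elim: Rats_cases)
  moreover have "\<theta> \<in> range ?E"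
    by (rule range_eqI[of _ _ "[:0, 1:]"]) (simp add: map_poly_pCons)
  ultimately have "rat_adjoin \<theta> \<subseteq> range ?E"
    unfolding rat_adjoin_def by (intro hull_minimal) auto
  with x that show ?thesis by blast
qed

lemma Z_span_powers:
  fixes \<alpha> :: "'a::field_char_0"
  assumes "x \<in> int_mod.span ((\<lambda>i. \<alpha> ^ i) ` A)"
  obtains g where "x = poly (map_poly of_int g) \<alpha>"
proof -
  let ?E = "\<lambda>g. poly (map_poly of_int g) \<alpha>"
  have "int_mod.span ((\<lambda>i. \<alpha> ^ i) ` A) \<subseteq> range ?E"
  proof (rule int_mod.span_minimal)
    show "(\<lambda>i. \<alpha> ^ i) ` A \<subseteq> range ?E"
    proof (rule image_subsetI)
      fix i
      show "\<alpha> ^ i \<in> range ?E"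
        by (rule range_eqI[of _ _ "monom 1 i"]) (simp add: map_poly_monom poly_monom)
    qed
    show "int_mod.subspace (range ?E)"
      unfolding int_mod.subspace_def
    proof (intro conjI ballI allI)
      show "0 \<in> range ?E" by (rule range_eqI[of _ _ 0]) simp
    next
      fix y z assume "y \<in> range ?E" "z \<in> range ?E"
      then obtain p q where "y = ?E p" "z = ?E q" by blast
      then show "y + z \<in> range ?E"
        using poly_of_int_hom(1)[of p q \<alpha>] by (metis rangeI)
    next
      fix c y assume "y \<in> range ?E"
      then obtain p where "y = ?E p" by blast
      then show "of_int c * y \<in> range ?E"
        using poly_of_int_hom(2)[of c p \<alpha>] by (metis rangeI)
    qed
  qed
  with assms that show ?thesis by blast
qed

section \<open>The order inside the field generated by \<theta>\<close>

context septic
begin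

text \<open>By Horner's scheme: each new coefficient multiplies the common denominator by its
  own.\<close>

lemma denominator:
  obtains D where "D \<noteq> 0" "of_int D * poly (map_poly of_rat g) \<theta> \<in> ord"
proof -
  have "\<exists>D\<noteq>0. of_int D * poly (map_poly of_rat g) \<theta> \<in> ord"
  proof (induction g)
    case 0
    show ?case by (intro exI[of _ 1]) (simp add: ord_0)
  next
    case (pCons a p)
    then obtain D where D: "D \<noteq> 0" "of_int D * poly (map_poly of_rat p) \<theta> \<in> ord" by blast
    obtain n d where q: "quotient_of a = (n, d)" by (cases "quotient_of a")
    have d: "d > 0" using quotient_of_denom_pos[OF q] .
    have n: "(of_int n :: 'a) = of_int d * of_rat a"
      using d by (simp add: quotient_of_div[OF q] of_rat_divide)
    have "of_int (D * d) * poly (map_poly of_rat (pCons a p)) \<theta> = of_int (D * n)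
        + of_int d * (\<theta> * (of_int D * poly (map_poly of_rat p) \<theta>))"
      unfolding map_poly_pCons[where f = of_rat, OF of_rat_0] poly_pCons of_int_mult n
      by (simp only: distrib_left mult_ac)
    also have "\<dots> \<in> ord"
      by (intro ord_add ord_mult ord_of_int D R_in_ord[OF basis_in_R(1)])
    finally show ?case using D(1) d by (intro exI[of _ "D * d"]) simp
  qed
  with that show ?thesis by blast
qed

lemma w_in_rat_adjoin: "w3 \<in> rat_adjoin \<theta>" "w6 \<in> rat_adjoin \<theta>"
proof -
  have "w3 = poly (map_poly of_rat (monom (1 / 4) 3)) \<theta>"
    by (simp add: map_poly_monom poly_monom w3_def of_rat_divide)
  then show "w3 \<in> rat_adjoin \<theta>"
    by (simp only: poly_in_rat_adjoin)
  have "w6 = poly (map_poly of_rat (monom (1 / 32) 6 + monom (1 / 8) 3)) \<theta>"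
    by (simp add: poly_of_rat_hom map_poly_monom poly_monom w6_def of_rat_divide field_simps)
  then show "w6 \<in> rat_adjoin \<theta>"
    by (simp only: poly_in_rat_adjoin)
qed

end

section \<open>Non-monogenicity of the septic field\<close>

theorem corollary1p4:
  fixes a b :: int and \<theta> :: "'a::field_char_0" and f :: "rat poly"
  defines "f \<equiv> monom 1 7 + monom (of_int a) 1 + monom (of_int b) 0"
  assumes "irreducible f"
    and "poly (map_poly of_rat f) \<theta> = 0"
    and "128 dvd a + 16" and "128 dvd b"
  shows "\<not> monogenic (rat_adjoin \<theta>)"
proof
  assume "monogenic (rat_adjoin \<theta>)"
  then obtain \<alpha> where \<alpha>: "\<alpha> \<in> ring_of_integers (rat_adjoin \<theta>)"
    and span: "int_mod.span ((\<lambda>i. \<alpha> ^ i) ` {..<field_degree (rat_adjoin \<theta>)})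
      = ring_of_integers (rat_adjoin \<theta>)"
    unfolding monogenic_def is_Z_basis_def by (elim bexE conjE)
  obtain k m where "a + 16 = 128 * k" "b = 128 * m"
    using assms(4,5) by (elim dvdE)
  then have km: "a = 128 * k - 16" "b = 128 * m"
    by simp_all
  have "degree f = 7"
    unfolding f_def by (intro antisym degree_le le_degree) (auto simp: coeff_monom)
  interpret septic \<theta> k m
  proof
    have "\<theta> ^ 7 + of_int a * \<theta> + of_int b = 0"
      using assms(3) by (simp add: f_def poly_of_rat_hom map_poly_monom poly_monom)
    then show "\<theta> ^ 7 = 16 * (1 - 8 * of_int k) * \<theta> - 128 * of_int m"
      unfolding km by (simp add: algebra_simps eq_neg_iff_add_eq_0)
    fix c :: "int poly"
    assume c: "degree c < 7" "poly (map_poly of_int c) \<theta> = 0"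
    let ?g = "map_poly of_int c :: rat poly"
    have g: "map_poly of_rat ?g = (map_poly of_int c :: 'a poly)"
      by (simp add: map_poly_map_poly o_def)
    \<comment> \<open>Otherwise the value of \<open>c\<close> at \<theta> would be invertible, but
      it is 0.\<close>
    have "f dvd ?g"
    proof (rule ccontr)
      assume "\<not> f dvd ?g"
      from irreducible_root_inverse[OF assms(2,3) this] show False
        unfolding g c(2) by simp
    qed
    moreover have "degree ?g < degree f"
      using c(1) by (simp add: \<open>degree f = 7\<close> degree_map_poly)
    ultimately have "?g = 0"
      by (metis dvd_imp_degree_le not_le)
    then show "c = 0"
      by (simp add: map_poly_eq_0_iff)
  qed
  have "\<alpha> \<in> rat_adjoin \<theta>" "algebraic_int \<alpha>"
    using \<alpha> by (auto simp: ring_of_integers_def)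
  obtain g where "\<alpha> = poly (map_poly of_rat g) \<theta>"
    using rat_adjoin_poly[OF assms(2,3) \<open>\<alpha> \<in> rat_adjoin \<theta>\<close>] .
  then obtain D where D: "D \<noteq> 0" "of_int D * \<alpha> \<in> ord"
    using denominator[of g] by blast
  have w3: "w3 \<in> ring_of_integers (rat_adjoin \<theta>)" and w6: "w6 \<in> ring_of_integers (rat_adjoin \<theta>)"
    using w_in_rat_adjoin algebraic_int_w3 algebraic_int_w6 by (simp_all add: ring_of_integers_def)
  \<comment> \<open>Being integral elements of the field, both lie in the span of the powers of
    \<alpha>.\<close>
  obtain g h where "w3 = poly (map_poly of_int g) \<alpha>" "w6 = poly (map_poly of_int h) \<alpha>"
    using Z_span_powers[OF w3[folded span]] Z_span_powers[OF w6[folded span]] by metis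
  then show False
    by (rule not_both_polynomials[OF \<open>algebraic_int \<alpha>\<close> D])
qed

end
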